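(* Let $(X,B)$ be an $(r,k,\lambda)$-BIBD. Let $\epsilon$ be a positive real number and let $t\ge 2$ be an integer. Let $P\subseteq X$ with $$|P| \geq (1+\epsilon)(t-1)\frac{|X|}{k}.$$ Then the number $\Gamma_t(P)$ of $t$-rich blocks satisfies $$\Gamma_t(P) \geq a\,|B|,\qquad\text{where}\qquad a = \frac{\epsilon^2(t-1)}{\epsilon^2(t-1) + \left(1-\frac{\lambda}{r}\right)(1+\epsilon)}.$$
   Context: Let $X$ be a finite nonempty set (the points) and let $B$ be a set of subsets of $X$ (the blocks). For integers $r,k\ge 1$ and $\lambda \ge 0$, $(X,B)$ is an $(r,k,\lambda)$-BIBD (balanced incomplete block design) if: each point is in exactly $r$ blocks; each block contains exactly $k$ points; each pair of distinct points is contained in exactly $\lambda$ blocks; and no single block contains all of the points. Given $P\subseteq X$, a block $b\in B$ is $t$-rich if it contains at least $t$ points of $P$, and $\Gamma_t(P) = |\{b\in B : |\{x\in P : x\in b\}|\ge t\}|$ is the number of $t$-rich blocks. *)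

theory Defs
  imports Complex_Main
begin

(* The parameter lam is the usual lambda of design theory. Blocks form a set,
   so designs have no repeated blocks. *)
definition bibd :: "'a set \<Rightarrow> 'a set set \<Rightarrow> nat \<Rightarrow> nat \<Rightarrow> nat \<Rightarrow> bool" where
  "bibd X B r k lam \<longleftrightarrow>
     finite X \<and> X \<noteq> {} \<and> (\<forall>b\<in>B. b \<subseteq> X) \<and> r \<ge> 1 \<and> k \<ge> 1 \<and>
     (\<forall>x\<in>X. card {b\<in>B. x \<in> b} = r) \<and>
     (\<forall>b\<in>B. card b = k) \<and>
     (\<forall>x\<in>X. \<forall>y\<in>X. x \<noteq> y \<longrightarrow> card {b\<in>B. x \<in> b \<and> y \<in> b} = lam) \<and>
     (\<forall>b\<in>B. \<not> X \<subseteq> b)"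

definition rich :: "nat \<Rightarrow> 'a set \<Rightarrow> 'a set \<Rightarrow> bool" where
  "rich t P b \<longleftrightarrow> card {x\<in>P. x \<in> b} \<ge> t"

definition num_rich :: "'a set set \<Rightarrow> nat \<Rightarrow> 'a set \<Rightarrow> nat" where
  "num_rich B t P = card {b\<in>B. rich t P b}"

end

theory Submission
  imports Defs
begin

text \<open>
  Give a block \<open>b\<close> the weight \<open>d b = card {x\<in>P. x \<in> b}\<close>. For a uniformly random block, the
  design axioms determine the first two moments of \<open>d\<close>: the number of blocks through a point
  gives the mean \<open>m = |P| k / |X|\<close>, and the number of blocks through a pair of points gives the
  second moment. The variance comes out as at most \<open>m c\<close> with \<open>c = 1 - \<lambda> / r\<close>, because distinct
  points of a design are non-positively correlated: \<open>\<lambda> |X| \<le> r k\<close>.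

  A block that is not \<open>t\<close>-rich has \<open>d b \<le> t - 1\<close>, which lies at least \<open>\<delta> = m - (t - 1)\<close> below the
  mean, and \<open>\<delta> > 0\<close> by the lower bound on \<open>|P|\<close>. Cantelli's one-sided form of
  Chebyshev's inequality bounds the proportion of such blocks by \<open>m c / (\<delta>\<^sup>2 + m c)\<close>; the
  two-sided inequality would only give \<open>m c / \<delta>\<^sup>2\<close> and lose the shape of the constant \<open>a\<close>.
  So at least the proportion \<open>\<delta>\<^sup>2 / (\<delta>\<^sup>2 + m c)\<close> of the blocks is rich. This increases
  with \<open>m\<close> when \<open>m \<ge> t - 1\<close>, and at the smallest admissible mean
  \<open>m = (1 + \<epsilon>) (t - 1)\<close> it equals \<open>a\<close>.
\<close>

text \<open>
  Cantelli's inequality for the uniform distribution on a finite set. For every shift \<open>u \<ge> 0\<close>, the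
  sum of \<open>(m + u - f b)\<^sup>2\<close> is at most \<open>(w + u\<^sup>2) |B|\<close>, while each element of the lower tail
  contributes at least \<open>(\<delta> + u)\<^sup>2\<close>. The best shift is \<open>u = w / \<delta>\<close>.
\<close>

lemma cantelli_lower_tail_count:
  fixes f :: "'b \<Rightarrow> real" and m w \<delta> :: real
  assumes "finite B" and mean: "(\<Sum>b\<in>B. f b) = m * card B"
    and var: "(\<Sum>b\<in>B. (f b - m)\<^sup>2) \<le> w * card B"
    and "w \<ge> 0" "\<delta> > 0"
  shows "card {b\<in>B. f b \<le> m - \<delta>} * (\<delta>\<^sup>2 + w) \<le> w * card B"
proof -
  define u where "u = w / \<delta>"
  define L where "L = {b\<in>B. f b \<le> m - \<delta>}"
  have u: "u \<ge> 0" "\<delta> * u = w" using assms by (auto simp: u_def)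
  have "card L * (\<delta> + u)\<^sup>2 = (\<Sum>b\<in>L. (\<delta> + u)\<^sup>2)" by simp
  also have "\<dots> \<le> (\<Sum>b\<in>L. (m + u - f b)\<^sup>2)"
    using u \<open>\<delta> > 0\<close> by (intro sum_mono power_mono) (auto simp: L_def)
  also have "\<dots> \<le> (\<Sum>b\<in>B. (m + u - f b)\<^sup>2)"
    using \<open>finite B\<close> by (intro sum_mono2) (auto simp: L_def)
  also have "\<dots> = (\<Sum>b\<in>B. (f b - m)\<^sup>2 + 2 * u * m + u\<^sup>2 - 2 * u * f b)"
    by (intro sum.cong) (auto simp: power2_eq_square algebra_simps)
  also have "\<dots> = (\<Sum>b\<in>B. (f b - m)\<^sup>2) + card B * (2 * u * m) + card B * u\<^sup>2
      - 2 * u * (\<Sum>b\<in>B. f b)"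
    by (simp add: sum.distrib sum_subtractf sum_distrib_left)
  also have "\<dots> = (\<Sum>b\<in>B. (f b - m)\<^sup>2) + u\<^sup>2 * card B"
    by (simp add: mean)
  also have "\<dots> \<le> (w + u\<^sup>2) * card B" using var by (simp add: algebra_simps)
  finally have "card L * (\<delta> + u)\<^sup>2 * \<delta>\<^sup>2 \<le> (w + u\<^sup>2) * card B * \<delta>\<^sup>2"
    by (rule mult_right_mono) simp
  also have "card L * (\<delta> + u)\<^sup>2 * \<delta>\<^sup>2 = card L * (\<delta>\<^sup>2 + \<delta> * u)\<^sup>2"
    by (simp add: power2_eq_square algebra_simps)
  also have "\<dots> = card L * (\<delta>\<^sup>2 + w) * (\<delta>\<^sup>2 + w)"
    by (simp add: u power2_eq_square)
  also have "(w + u\<^sup>2) * card B * \<delta>\<^sup>2 = (w * \<delta>\<^sup>2 + (\<delta> * u)\<^sup>2) * card B"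
    by (simp add: power2_eq_square algebra_simps)
  also have "\<dots> = w * card B * (\<delta>\<^sup>2 + w)"
    by (simp add: u power2_eq_square algebra_simps)
  finally have "card L * (\<delta>\<^sup>2 + w) * (\<delta>\<^sup>2 + w) \<le> w * card B * (\<delta>\<^sup>2 + w)" .
  moreover have "\<delta>\<^sup>2 + w > 0" using assms by (simp add: add_pos_nonneg)
  ultimately show ?thesis unfolding L_def by (rule mult_right_le_imp_le)
qed

lemma bibd_finite_blocks: "bibd X B r k lam \<Longrightarrow> finite B"
  unfolding bibd_def by (meson PowI finite_Pow_iff finite_subset subsetI)

lemma bibd_sum_inter_card:
  assumes "bibd X B r k lam" "P \<subseteq> X"
  shows "(\<Sum>b\<in>B. real (card {x\<in>P. x \<in> b})) = card P * real r"
proof -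
  have fin: "finite B" "finite P"
    using bibd_finite_blocks[OF assms(1)] assms by (auto simp: bibd_def intro: finite_subset)
  have "(\<Sum>b\<in>B. card {x\<in>P. x \<in> b}) = r * card P"
    using fin assms by (intro sum_multicount) (auto simp: bibd_def)
  thus ?thesis by (metis mult.commute of_nat_mult of_nat_sum)
qed

text \<open>
  Expanding \<open>d\<^sup>2\<close> counts ordered pairs of points of \<open>P\<close> lying in a common block: a pair of
  distinct points lies in \<open>lam\<close> blocks, a pair \<open>(x, x)\<close> in \<open>r\<close> blocks.
\<close>

lemma bibd_sum_inter_card_squared:
  assumes "bibd X B r k lam" "P \<subseteq> X"
  shows "(\<Sum>b\<in>B. (real (card {x\<in>P. x \<in> b}))\<^sup>2)
    = card P * (real r - real lam) + (card P)\<^sup>2 * real lam"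
proof -
  have fin: "finite B" "finite P"
    using bibd_finite_blocks[OF assms(1)] assms by (auto simp: bibd_def intro: finite_subset)
  have pairs: "real (card {b\<in>B. x \<in> b \<and> y \<in> b}) = lam + (if x = y then real r - lam else 0)"
    if "x \<in> P" "y \<in> P" for x y
  proof -
    have "x \<in> X" "y \<in> X" using that assms(2) by auto
    thus ?thesis using assms(1) by (cases "x = y") (simp_all add: bibd_def)
  qed
  have "(\<Sum>b\<in>B. (real (card {x\<in>P. x \<in> b}))\<^sup>2)
      = (\<Sum>b\<in>B. \<Sum>x\<in>P. \<Sum>y\<in>P. of_bool (x \<in> b \<and> y \<in> b))"
  proof (rule sum.cong)
    fix b assume "b \<in> B"
    have "real (card {x\<in>P. x \<in> b}) = (\<Sum>x\<in>P. of_bool (x \<in> b))"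
      using fin by (simp add: Int_def)
    thus "(real (card {x\<in>P. x \<in> b}))\<^sup>2 = (\<Sum>x\<in>P. \<Sum>y\<in>P. of_bool (x \<in> b \<and> y \<in> b))"
      by (simp add: power2_eq_square sum_product of_bool_conj)
  qed simp
  also have "\<dots> = (\<Sum>x\<in>P. \<Sum>b\<in>B. \<Sum>y\<in>P. of_bool (x \<in> b \<and> y \<in> b))"
    by (rule sum.swap)
  also have "\<dots> = (\<Sum>x\<in>P. \<Sum>y\<in>P. \<Sum>b\<in>B. of_bool (x \<in> b \<and> y \<in> b))"
    by (intro sum.cong refl sum.swap)
  also have "\<dots> = (\<Sum>x\<in>P. \<Sum>y\<in>P. real (card {b\<in>B. x \<in> b \<and> y \<in> b}))"
    using fin by (simp add: Int_def)
  also have "\<dots> = (\<Sum>x\<in>P. \<Sum>y\<in>P. lam + (if x = y then real r - lam else 0))"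
    using pairs by (intro sum.cong) auto
  also have "\<dots> = (\<Sum>x\<in>P. real (card P) * lam + (real r - lam))"
    using fin by (intro sum.cong) (simp_all add: sum.distrib)
  also have "\<dots> = card P * (real r - real lam) + (card P)\<^sup>2 * real lam"
    by (simp add: power2_eq_square algebra_simps)
  finally show ?thesis .
qed

lemma bibd_inter_all_points:
  assumes "bibd X B r k lam" "b \<in> B"
  shows "card {x\<in>X. x \<in> b} = k"
proof -
  have "{x\<in>X. x \<in> b} = b" using assms by (auto simp: bibd_def)
  thus ?thesis using assms by (simp add: bibd_def)
qed

lemma bibd_flag_count:
  assumes "bibd X B r k lam"
  shows "card B * real k = card X * real r"
  using bibd_sum_inter_card[OF assms subset_refl]
  by (simp add: bibd_inter_all_points[OF assms])

text \<open>
  Among the blocks through a point are those that also pass through a second one. A second point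
  exists because a block through the first does not contain all points.
\<close>

lemma bibd_index_le_replication:
  assumes "bibd X B r k lam"
  shows "lam \<le> r"
proof -
  obtain x where x: "x \<in> X" using assms by (auto simp: bibd_def)
  hence "card {b\<in>B. x \<in> b} \<noteq> 0" using assms by (auto simp: bibd_def)
  then obtain b where b: "b \<in> B" "x \<in> b" by (auto simp: card_eq_0_iff)
  then obtain y where y: "y \<in> X" "y \<notin> b" using assms unfolding bibd_def by blast
  have "card {b\<in>B. x \<in> b \<and> y \<in> b} \<le> card {b\<in>B. x \<in> b}"
    using bibd_finite_blocks[OF assms] by (intro card_mono) auto
  thus ?thesis using assms x y b by (auto simp: bibd_def)
qed

text \<open>
  Non-positive correlation of points: two distinct points share at most as many blocks as they would if
  independent. It follows from the second moment for \<open>P = X\<close>, where every block has weight \<open>k\<close>,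
  which amounts to the classical identity \<open>r (k - 1) = lam (|X| - 1)\<close>.
\<close>

lemma bibd_index_mult_points_le:
  assumes "bibd X B r k lam"
  shows "real lam * card X \<le> real r * k"
proof -
  have X: "card X > 0" using assms by (auto simp: bibd_def card_gt_0_iff)
  have "card X * (real r * k) = (card B * real k) * k"
    by (simp add: bibd_flag_count[OF assms])
  also have "\<dots> = card B * (real k)\<^sup>2" by (simp add: power2_eq_square)
  also have "\<dots> = card X * (real r - real lam) + (card X)\<^sup>2 * real lam"
    using bibd_sum_inter_card_squared[OF assms subset_refl]
    by (simp add: bibd_inter_all_points[OF assms])
  also have "\<dots> = card X * (real r - real lam + card X * real lam)"
    by (simp add: power2_eq_square algebra_simps)
  finally have "card X * (real r * k) = card X * (real r - real lam + card X * real lam)" .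
  hence "real r * k = real r - real lam + card X * real lam" using X by simp
  thus ?thesis using bibd_index_le_replication[OF assms] by (simp add: mult.commute)
qed

text \<open>The ratio \<open>(m - s)\<^sup>2 / m\<close> increases with \<open>m\<close> on \<open>m \<ge> s\<close>.\<close>

lemma squared_gap_ratio_mono:
  fixes s m :: real
  assumes "s \<ge> 0" "\<epsilon> \<ge> 0" "m \<ge> (1 + \<epsilon>) * s"
  shows "\<epsilon>\<^sup>2 * s * m \<le> (m - s)\<^sup>2 * (1 + \<epsilon>)"
proof -
  define h where "h = m - (1 + \<epsilon>) * s"
  \<comment> \<open>The difference of the two sides vanishes at the smallest value of \<open>m\<close>, hence is a
      polynomial in the excess \<open>h\<close> without constant term; its coefficients are nonnegative.\<close>
  have "(m - s)\<^sup>2 * (1 + \<epsilon>) - \<epsilon>\<^sup>2 * s * m = (1 + \<epsilon>) * h\<^sup>2 + (2 + \<epsilon>) * \<epsilon> * s * h"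
    by (simp add: h_def power2_eq_square algebra_simps)
  moreover have "\<dots> \<ge> 0" using assms by (simp add: h_def)
  ultimately show ?thesis by linarith
qed

theorem theorem3:
  fixes X P :: "'a set" and B :: "'a set set"
    and r k lam t :: nat and \<epsilon> :: real
  assumes "bibd X B r k lam"
    and "\<epsilon> > 0"
    and "t \<ge> 2"
    and "P \<subseteq> X"
    and "real (card P) \<ge> (1 + \<epsilon>) * (real t - 1) * (real (card X) / real k)"
  shows "real (num_rich B t P) \<ge>
    (\<epsilon>\<^sup>2 * (real t - 1)) /
      (\<epsilon>\<^sup>2 * (real t - 1) + (1 - real lam / real r) * (1 + \<epsilon>)) * real (card B)"
proof -
  define s where "s = real t - 1"
  define c where "c = 1 - real lam / real r"
  define m where "m = real (card P) * k / card X"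
  define \<delta> where "\<delta> = m - s"
  define d where "d b = real (card {x\<in>P. x \<in> b})" for b
  define G where "G = real (num_rich B t P)"
  have pos: "real (card X) > 0" "real k > 0" "real r > 0"
    using assms(1) by (auto simp: bibd_def card_gt_0_iff)
  have s: "s > 0" using assms(3) by (simp add: s_def)
  have c: "c \<ge> 0"
    using bibd_index_le_replication[OF assms(1)] pos by (simp add: c_def)
  have fin: "finite B" by (rule bibd_finite_blocks[OF assms(1)])
  have m: "m \<ge> (1 + \<epsilon>) * s"
    using assms(5) pos by (simp add: m_def s_def field_simps)
  have "\<epsilon> * s > 0" using s assms(2) by simp
  hence \<delta>: "\<delta> > 0" using m by (simp add: \<delta>_def algebra_simps)
  have m_pos: "m > 0" using \<delta> s by (simp add: \<delta>_def)
  have mn: "m * card B = card P * real r"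
  proof -
    have "m * card B = card P * (card B * real k) / card X" by (simp add: m_def)
    thus ?thesis using pos by (simp add: bibd_flag_count[OF assms(1)])
  qed
  have mean: "(\<Sum>b\<in>B. d b) = m * card B"
    using bibd_sum_inter_card[OF assms(1,4)] mn by (simp add: d_def)

  have correlation: "(card P)\<^sup>2 * real lam \<le> m * (m * card B)"
  proof -
    have "real lam \<le> real r * k / card X"
      using bibd_index_mult_points_le[OF assms(1)] pos by (simp add: field_simps)
    hence "(card P)\<^sup>2 * real lam \<le> (card P)\<^sup>2 * (real r * k / card X)"
      by (rule mult_left_mono) simp
    also have "\<dots> = m * (m * card B)"
      unfolding mn by (simp add: m_def power2_eq_square)
    finally show ?thesis .
  qed
  have "(\<Sum>b\<in>B. (d b - m)\<^sup>2) = (\<Sum>b\<in>B. (d b)\<^sup>2 + m\<^sup>2 - 2 * m * d b)"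
    by (intro sum.cong) (auto simp: power2_eq_square algebra_simps)
  also have "\<dots> = (\<Sum>b\<in>B. (d b)\<^sup>2) + card B * m\<^sup>2 - 2 * m * (\<Sum>b\<in>B. d b)"
    by (simp add: sum.distrib sum_subtractf sum_distrib_left)
  also have "\<dots> = (\<Sum>b\<in>B. (d b)\<^sup>2) - m * (m * card B)"
    by (simp add: mean power2_eq_square)
  also have "\<dots> \<le> card P * (real r - real lam)"
    using bibd_sum_inter_card_squared[OF assms(1,4)] correlation by (simp add: d_def)
  also have "\<dots> = c * (card P * real r)"
    using pos by (simp add: c_def field_simps)
  also have "\<dots> = m * c * card B" by (simp flip: mn)
  finally have var: "(\<Sum>b\<in>B. (d b - m)\<^sup>2) \<le> m * c * card B" .

  have poor: "{b\<in>B. d b \<le> m - \<delta>} = B - {b\<in>B. rich t P b}"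
    using assms(3) by (auto simp: \<delta>_def s_def d_def rich_def)
  have "real (card (B - {b\<in>B. rich t P b})) = card B - G"
    using fin by (simp add: G_def num_rich_def card_Diff_subset card_mono of_nat_diff)
  hence "(card B - G) * (\<delta>\<^sup>2 + m * c) \<le> m * c * card B"
    using cantelli_lower_tail_count[OF fin mean var _ \<delta>] c m_pos by (simp add: poor)
  hence G: "\<delta>\<^sup>2 * card B \<le> (\<delta>\<^sup>2 + m * c) * G" by (simp add: algebra_simps)

  define A where "A = \<epsilon>\<^sup>2 * s"
  define C where "C = c * (1 + \<epsilon>)"
  have AC: "A > 0" "C \<ge> 0" using s c assms(2) by (auto simp: A_def C_def)
  have G0: "G \<ge> 0" by (simp add: G_def)
  have "A * m \<le> \<delta>\<^sup>2 * (1 + \<epsilon>)"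
    using squared_gap_ratio_mono[OF _ _ m] s assms(2) by (simp add: A_def \<delta>_def)
  hence "A * m * (c * G) \<le> \<delta>\<^sup>2 * (1 + \<epsilon>) * (c * G)"
    using c G0 by (intro mult_right_mono) auto
  moreover have "A * (\<delta>\<^sup>2 * card B) \<le> A * ((\<delta>\<^sup>2 + m * c) * G)"
    using G AC by (intro mult_left_mono) auto
  ultimately have "\<delta>\<^sup>2 * (A * card B) \<le> \<delta>\<^sup>2 * ((A + C) * G)"
    by (simp add: C_def algebra_simps)
  hence "A * card B \<le> (A + C) * G" using \<delta> by simp
  hence "A / (A + C) * card B \<le> G" using AC by (simp add: field_simps)
  thus ?thesis by (simp add: A_def C_def G_def c_def s_def)
qed

end
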